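(* Let $\alpha>0$ and $\beta\in\mathbb{R}$, and put $\beta_-:=\max(-\beta,0)$. Then $m(\alpha+\beta\delta_0)=2\sqrt{\alpha}-\beta_-$. In particular, if $2\sqrt{\alpha}+\beta>0$, then the inequality $$\|u\|_\infty\le C\left(\int_{\mathbb{R}}\big(|u'(x)|^2+\alpha|u(x)|^2\big)\,dx+\beta|u(0)|^2\right)^{1/2}\qquad(u\in H^1(\mathbb{R}))$$ holds, and its best (smallest) constant is $C=(2\sqrt{\alpha}-\beta_-)^{-1/2}$.
   Context: Elements of $H^1(\mathbb{R})$ are identified with their continuous representatives; $\|u\|_\infty:=\|u\|_{L^\infty(\mathbb{R})}$. For a bounded symmetric bilinear form $V$ on $H^1(\mathbb{R})$ set $I(u;V):=\|u'\|_{L^2(\mathbb{R})}^2+V(u,u)$ and $m(V):=\inf_{u\in H^1(\mathbb{R}),\,u\not\equiv0} I(u;V)/\|u\|_\infty^2$. Here $\alpha+\beta\delta_0$ denotes the form $(u,v)\mapsto\int_{\mathbb{R}}\alpha uv\,dx+\beta u(0)v(0)$. *)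

theory Defs
  imports "HOL-Analysis.Analysis" "HOL-Probability.Essential_Supremum"
begin

definition test_fun :: "(real \<Rightarrow> real) \<Rightarrow> bool" where
  "test_fun \<phi> \<longleftrightarrow> (\<forall>k x. ((deriv ^^ k) \<phi>) differentiable (at x))
      \<and> (\<exists>R. \<forall>x. \<bar>x\<bar> > R \<longrightarrow> \<phi> x = 0)"

definition L2 :: "(real \<Rightarrow> real) \<Rightarrow> bool" where
  "L2 f \<longleftrightarrow> f \<in> borel_measurable lborel \<and> integrable lborel (\<lambda>x. (f x)\<^sup>2)"

definition weak_deriv_L2 :: "(real \<Rightarrow> real) \<Rightarrow> (real \<Rightarrow> real) \<Rightarrow> bool" where
  "weak_deriv_L2 u g \<longleftrightarrow> L2 u \<and> L2 g \<and>
     (\<forall>\<phi>. test_fun \<phi> \<longrightarrow>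
        (LINT x|lborel. u x * deriv \<phi> x) = - (LINT x|lborel. g x * \<phi> x))"

text \<open>H1(R), elements identified with their continuous representatives.\<close>
definition H1 :: "(real \<Rightarrow> real) set" where
  "H1 = {u. continuous_on UNIV u \<and> (\<exists>g. weak_deriv_L2 u g)}"

definition wderiv :: "(real \<Rightarrow> real) \<Rightarrow> real \<Rightarrow> real" where
  "wderiv u = (SOME g. weak_deriv_L2 u g)"

definition sup_norm :: "(real \<Rightarrow> real) \<Rightarrow> real" where
  "sup_norm u = real_of_ereal (esssup lborel (\<lambda>x. ereal \<bar>u x\<bar>))"

definition Ifun :: "(real \<Rightarrow> real) \<Rightarrow> ((real \<Rightarrow> real) \<Rightarrow> (real \<Rightarrow> real) \<Rightarrow> real) \<Rightarrow> real" where
  "Ifun u V = (LINT x|lborel. (wderiv u x)\<^sup>2) + V u u"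

definition mV :: "((real \<Rightarrow> real) \<Rightarrow> (real \<Rightarrow> real) \<Rightarrow> real) \<Rightarrow> ereal" where
  "mV V = (INF u \<in> H1 - {\<lambda>x. 0}. ereal (Ifun u V / (sup_norm u)\<^sup>2))"

definition delta_form :: "real \<Rightarrow> real \<Rightarrow> (real \<Rightarrow> real) \<Rightarrow> (real \<Rightarrow> real) \<Rightarrow> real" where
  "delta_form \<alpha> \<beta> u v = (LINT x|lborel. \<alpha> * u x * v x) + \<beta> * u 0 * v 0"

end

theory Submission
  imports Defs
begin

text \<open>
  With \<open>s = sqrt \<alpha>\<close>, test the weak derivative against smooth cutoffs of the one-sided exponential
  \<open>w x = exp (- s (x - a))\<close> on \<open>x > a\<close>. Passing to the limit gives \<open>u a = \<integral> w (s u - u')\<close>, and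
  completing the square yields \<open>\<integral>\<^bsub>x > a\<^esub> u'\<^sup>2 + s\<^sup>2 u\<^sup>2 \<ge> s (u a)\<^sup>2\<close>. Adding the reflected
  estimate on \<open>x < a\<close> gives \<open>\<integral> u'\<^sup>2 + \<alpha> u\<^sup>2 \<ge> 2 s (u a)\<^sup>2\<close> for every \<open>a\<close>, which is the lower bound for
  \<open>m\<close>, as \<open>\<beta> (u 0)\<^sup>2 \<ge> - \<beta>\<^sub>- \<parallel>u\<parallel>\<^sup>2\<close>. The peaks \<open>exp (- s \<bar>x - a\<bar>)\<close> have quotient
  \<open>2 s + \<beta> exp (- 2 s \<bar>a\<bar>)\<close>; take \<open>a = 0\<close> if \<open>\<beta> < 0\<close> and \<open>a \<rightarrow> \<infinity>\<close> otherwise.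
  The representation of \<open>u a\<close> also shows that weak derivatives are unique almost everywhere, which
  is needed because \<^const>\<open>wderiv\<close> picks an arbitrary one.
\<close>

subsection \<open>Smooth functions\<close>

text \<open>The differentiability half of \<open>test_fun\<close>, split off so that closure under
  products, shifts and antiderivatives can be shown without tracking supports.\<close>

definition smooth :: "(real \<Rightarrow> real) \<Rightarrow> bool" where
  "smooth f \<longleftrightarrow> (\<forall>k x. ((deriv ^^ k) f) differentiable (at x))"

text \<open>A class of functions closed under differentiation contains all iterated derivatives of
  its members. Smoothness thus reduces to one derivative at a time, with no formula for the
  \<open>k\<close>-th one.\<close>

lemma smooth_coinduct:
  assumes "P f" and "\<And>h. P h \<Longrightarrow> \<exists>h'. (\<forall>x. (h has_field_derivative h' x) (at x)) \<and> P h'"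
  shows "smooth f"
proof -
  have step: "P (deriv h) \<and> (\<forall>x. h differentiable (at x))" if "P h" for h
  proof -
    obtain h' where h': "\<And>x. (h has_field_derivative h' x) (at x)" "P h'"
      using assms(2) \<open>P h\<close> by blast
    then have "deriv h = h'" by (auto intro: DERIV_imp_deriv)
    with h' show ?thesis
      by (auto simp: real_differentiable_def)
  qed
  have "P ((deriv ^^ k) f)" for k
    by (induction k) (use assms(1) step in auto)
  then show ?thesis using step by (auto simp: smooth_def)
qed

lemma smooth_DERIV: "smooth f \<Longrightarrow> (f has_field_derivative deriv f x) (at x)"
  unfolding smooth_def by (drule spec[of _ 0]) (auto simp: DERIV_deriv_iff_real_differentiable)

lemma smooth_deriv: "smooth f \<Longrightarrow> smooth (deriv f)"
  unfolding smooth_def by (metis comp_apply funpow_Suc_right)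

lemma smooth_continuous: "smooth f \<Longrightarrow> continuous_on S f"
  by (meson DERIV_isCont continuous_at_imp_continuous_on smooth_DERIV)

text \<open>Adding \<open>F\<close> to the class of smooth functions keeps it closed under
  differentiation.\<close>

lemma smooth_antideriv:
  assumes "smooth f" "\<And>x. (F has_field_derivative f x) (at x)"
  shows "smooth F"
proof (rule smooth_coinduct[where P="\<lambda>h. h = F \<or> smooth h"])
  fix h assume "h = F \<or> smooth h"
  then show "\<exists>h'. (\<forall>x. (h has_field_derivative h' x) (at x)) \<and> (h' = F \<or> smooth h')"
    using assms smooth_DERIV smooth_deriv by blast
qed simp

text \<open>A class containing \<open>f g\<close> that is closed under differentiation, by the Leibniz rule.\<close>

inductive product_span :: "(real \<Rightarrow> real) \<Rightarrow> bool" where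
  product: "smooth f \<Longrightarrow> smooth g \<Longrightarrow> product_span (\<lambda>x. f x * g x)"
| add: "product_span f \<Longrightarrow> product_span g \<Longrightarrow> product_span (\<lambda>x. f x + g x)"

lemma smooth_mult:
  assumes "smooth f" "smooth g"
  shows "smooth (\<lambda>x. f x * g x)"
proof (rule smooth_coinduct[where P=product_span])
  show "product_span (\<lambda>x. f x * g x)" using assms by (rule product)
  fix h assume "product_span h"
  then show "\<exists>h'. (\<forall>x. (h has_field_derivative h' x) (at x)) \<and> product_span h'"
  proof induction
    case (product f g)
    have "((\<lambda>x. f x * g x) has_field_derivative deriv f x * g x + f x * deriv g x) (at x)" for x
      using product by (auto intro!: derivative_eq_intros smooth_DERIV)
    moreover have "product_span (\<lambda>x. deriv f x * g x + f x * deriv g x)"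
      using product by (intro product_span.intros smooth_deriv)
    ultimately show ?case by (intro exI[of _ "\<lambda>x. deriv f x * g x + f x * deriv g x"]) blast
  next
    case (add f g)
    then show ?case
      by (metis (mono_tags, lifting) DERIV_add product_span.add)
  qed
qed

text \<open>Each differentiation produces a further factor \<open>c\<close>; the free scalar
  \<open>m\<close> absorbs it, so the class of such functions is closed.\<close>

lemma smooth_affine:
  assumes "smooth f"
  shows "smooth (\<lambda>x. m * f (c * x + d))"
proof (rule smooth_coinduct[where P="\<lambda>h. \<exists>m g. smooth g \<and> h = (\<lambda>x. m * g (c * x + d))"])
  show "\<exists>m' g. smooth g \<and> (\<lambda>x. m * f (c * x + d)) = (\<lambda>x. m' * g (c * x + d))"
    using assms by blast
  fix h assume "\<exists>m g. smooth g \<and> h = (\<lambda>x. m * g (c * x + d))"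
  then obtain m g where g: "smooth g" "h = (\<lambda>x. m * g (c * x + d))" by blast
  have "(h has_field_derivative (m * c) * deriv g (c * x + d)) (at x)" for x
    unfolding g(2)
    by (auto intro!: derivative_eq_intros DERIV_chain2[of g] smooth_DERIV g(1))
  moreover have "\<exists>k g'. smooth g' \<and> (\<lambda>x. (m * c) * deriv g (c * x + d)) = (\<lambda>x. k * g' (c * x + d))"
    using smooth_deriv[OF g(1)] by blast
  ultimately show "\<exists>h'. (\<forall>x. (h has_field_derivative h' x) (at x)) \<and>
      (\<exists>m g. smooth g \<and> h' = (\<lambda>x. m * g (c * x + d)))"
    by (intro exI[of _ "\<lambda>x. (m * c) * deriv g (c * x + d)"]) blast
qed

lemma smooth_exp: "smooth exp"
  by (rule smooth_coinduct[where P="\<lambda>h. h = exp"]) (auto intro!: exI[of _ exp])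

section \<open>A flat function and a smooth step\<close>

lemma poly_times_exp_minus_tendsto_0:
  "((\<lambda>x. poly p x * exp (- x)) \<longlongrightarrow> 0) at_top" for p :: "real poly"
proof -
  have "((\<lambda>x. \<Sum>i\<le>degree p. coeff p i * (x ^ i / exp x)) \<longlongrightarrow> (\<Sum>i\<le>degree p. coeff p i * 0)) at_top"
    by (intro tendsto_intros tendsto_power_div_exp_0)
  then show ?thesis
    by (simp add: poly_altdef sum_distrib_right exp_minus divide_inverse mult.assoc)
qed

text \<open>The classical \<open>exp (- 1 / x)\<close> extended by zero, with a polynomial factor in
  \<open>1 / x\<close> because its derivatives are all of this shape.\<close>

definition flat :: "real poly \<Rightarrow> real \<Rightarrow> real" where
  "flat p x = (if x > 0 then poly p (inverse x) * exp (- inverse x) else 0)"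

text \<open>With \<open>y = 1 / x\<close> one has \<open>dy / dx = - y^2\<close>, so
  \<open>p(y) exp(-y)\<close> has derivative \<open>y^2 (p(y) - p'(y)) exp(-y)\<close>;
  \<open>[:0, 0, 1:]\<close> is the factor \<open>y^2\<close>.\<close>

lemma flat_DERIV: "(flat p has_field_derivative flat ([:0, 0, 1:] * (p - pderiv p)) x) (at x)"
proof -
  consider "x > 0" | "x < 0" | "x = 0" by linarith
  then show ?thesis
  proof cases
    case 1
    have "((\<lambda>x. poly p (inverse x) * exp (- inverse x)) has_field_derivative
        flat ([:0, 0, 1:] * (p - pderiv p)) x) (at x)"
      using 1 by (auto intro!: derivative_eq_intros DERIV_chain2[OF poly_DERIV] simp: flat_def field_simps power2_eq_square)
    then show ?thesis
      using 1 by (elim has_field_derivative_transform_within_open[where S="{0<..}"]) (auto simp: flat_def)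
  next
    case 2
    then have "((\<lambda>x. 0) has_field_derivative flat ([:0, 0, 1:] * (p - pderiv p)) x) (at x)"
      by (simp add: flat_def)
    then show ?thesis
      using 2 by (elim has_field_derivative_transform_within_open[where S="{..<0}"]) (auto simp: flat_def)
  next
    case 3
    \<comment> \<open>The right difference quotient at 0 is \<open>y p(y) exp(-y)\<close> with
      \<open>y = 1 / h\<close>; the division by \<open>h\<close> turns \<open>p\<close> into
      \<open>[:0, 1:] * p\<close>.\<close>
    have "((\<lambda>h. poly ([:0, 1:] * p) (inverse h) * exp (- inverse h)) \<longlongrightarrow> 0) (at_right 0)"
      by (rule filterlim_compose[OF poly_times_exp_minus_tendsto_0 filterlim_inverse_at_top_right])
    then have "((\<lambda>h. flat p h / h) \<longlongrightarrow> 0) (at_right 0)"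
      by (rule Lim_transform_eventually)
        (auto simp: eventually_at_right_field flat_def field_simps intro!: exI[of _ 1])
    moreover have "((\<lambda>h. flat p h / h) \<longlongrightarrow> 0) (at_left 0)"
      by (rule Lim_transform_eventually[OF tendsto_const])
        (auto simp: eventually_at_left_field flat_def intro!: exI[of _ "-1"])
    ultimately show ?thesis
      using 3 by (simp add: DERIV_def filterlim_split_at flat_def)
  qed
qed

lemma smooth_flat: "smooth (flat p)"
proof (rule smooth_coinduct[where P="\<lambda>h. \<exists>p. h = flat p"])
  fix h assume "\<exists>p. h = flat p"
  then show "\<exists>h'. (\<forall>x. (h has_field_derivative h' x) (at x)) \<and> (\<exists>p. h' = flat p)"
    using flat_DERIV by blast
qed blast

text \<open>The step is the normalised antiderivative of a bump supported in
  \<open>[0, 1]\<close>.\<close>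

lemma smooth_step_exists:
  obtains H where "smooth H" "\<And>x. x \<le> 0 \<Longrightarrow> H x = 0" "\<And>x. x \<ge> 1 \<Longrightarrow> H x = 1"
    "\<And>x. x \<le> 0 \<or> x \<ge> 1 \<Longrightarrow> deriv H x = 0" "\<And>x. 0 \<le> H x" "\<And>x. H x \<le> 1"
proof -
  define r where "r x = flat 1 x * flat 1 (1 - x)" for x
  have smr: "smooth r"
    unfolding r_def using smooth_mult[OF smooth_flat smooth_affine[OF smooth_flat, of 1 1 "-1" 1]]
    by simp
  have r: "r x \<ge> 0" "x \<le> 0 \<or> x \<ge> 1 \<Longrightarrow> r x = 0" "0 < x \<Longrightarrow> x < 1 \<Longrightarrow> r x > 0" for x
    by (auto simp: r_def flat_def)
  \<comment> \<open>The antiderivative is taken on the whole line, since the step must be smooth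
    outside \<open>[0, 1]\<close> as well.\<close>
  have "\<exists>F. \<forall>x :: real. - \<infinity> < ereal x \<longrightarrow> ereal x < \<infinity> \<longrightarrow> (F has_vector_derivative r x) (at x)"
    by (rule einterval_antiderivative)
      (use smooth_continuous[OF smr, of UNIV] in \<open>auto simp: continuous_on_eq_continuous_at\<close>)
  then obtain F where F: "\<And>x. (F has_field_derivative r x) (at x)"
    by (auto simp: has_real_derivative_iff_has_vector_derivative)
  have mono: "F x \<le> F y" if "x \<le> y" for x y
    by (rule DERIV_nonneg_imp_nondecreasing[OF that]) (use F r(1) in blast)
  have F01: "F 0 < F 1"
  proof (rule DERIV_pos_imp_increasing_open[of 0 1 F])
    show "\<exists>y. (F has_field_derivative y) (at x) \<and> 0 < y" if "0 < x" "x < 1" for x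
      using F r(3)[OF that] by blast
    show "continuous_on {0..1} F"
      by (rule DERIV_continuous_on[OF has_field_derivative_at_within[OF F]])
  qed simp
  \<comment> \<open>On an interval lying left of 0 or right of 1 the bump vanishes, so
    \<open>F\<close> is nonincreasing there as well as nondecreasing.\<close>
  have const: "F x = F y" if "x \<le> y" "y \<le> 0 \<or> x \<ge> 1" for x y
  proof -
    have "F y \<le> F x"
    proof (rule DERIV_nonpos_imp_nonincreasing[OF that(1)])
      fix z assume "x \<le> z" "z \<le> y"
      then have "r z = 0" using that(2) r(2) by force
      with F[of z] show "\<exists>y. (F has_field_derivative y) (at z) \<and> y \<le> 0" by auto
    qed
    with mono[OF that(1)] show ?thesis by simp
  qed
  define H where "H x = (F x - F 0) / (F 1 - F 0)" for x
  have HD: "(H has_field_derivative (1 / (F 1 - F 0)) * r x) (at x)" for x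
    unfolding H_def using F01 by (auto intro!: derivative_eq_intros F)
  show thesis
  proof
    show "smooth H"
      using smooth_antideriv[OF smooth_affine[OF smr, of "1 / (F 1 - F 0)" 1 0]] HD by simp
    show low: "H x = 0" if "x \<le> 0" for x
      using const[of x 0] that by (simp add: H_def)
    show high: "H x = 1" if "x \<ge> 1" for x
      using const[of 1 x] that F01 by (simp add: H_def)
    show "deriv H x = 0" if "x \<le> 0 \<or> x \<ge> 1" for x
      using DERIV_imp_deriv[OF HD, of x] r(2)[OF that] by simp
    show "0 \<le> H x" for x
    proof (cases "x \<le> 0")
      case False
      then have "F 0 \<le> F x" by (intro mono) simp
      with F01 show ?thesis unfolding H_def by (intro divide_nonneg_pos) simp_all
    qed (simp add: low)
    show "H x \<le> 1" for x
    proof (cases "x \<ge> 1")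
      case False
      then have "F x \<le> F 1" by (intro mono) simp
      with F01 show ?thesis unfolding H_def by (subst pos_divide_le_eq) simp_all
    qed (simp add: high)
  qed
qed

subsection \<open>Representation of point values\<close>

lemma L2_measurable: "L2 f \<Longrightarrow> f \<in> borel_measurable borel"
  and L2_integrable: "L2 f \<Longrightarrow> integrable lborel (\<lambda>x. (f x)\<^sup>2)"
  by (auto simp: L2_def)

lemma L2_mult_integrable:
  assumes "L2 f" "L2 g"
  shows "integrable lborel (\<lambda>x. f x * g x)"
proof (rule Bochner_Integration.integrable_bound)
  show "integrable lborel (\<lambda>x. (f x)\<^sup>2 + (g x)\<^sup>2)"
    using assms by (intro Bochner_Integration.integrable_add L2_integrable)
  show "(\<lambda>x. f x * g x) \<in> borel_measurable lborel"
    using assms by (auto dest!: L2_measurable)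
  have "\<bar>p * q\<bar> \<le> p\<^sup>2 + q\<^sup>2" for p q :: real
    using sum_squares_bound[of "\<bar>p\<bar>" "\<bar>q\<bar>"] mult_nonneg_nonneg[of "\<bar>p\<bar>" "\<bar>q\<bar>"]
    unfolding abs_mult power2_abs by linarith
  then show "AE x in lborel. norm (f x * g x) \<le> norm ((f x)\<^sup>2 + (g x)\<^sup>2)"
    by simp
qed

section \<open>The one-sided exponential\<close>

text \<open>The fundamental solution of \<open>w' + s w = \<delta>\<close> with the Dirac mass at
  \<open>a\<close>; testing this equation against \<open>u\<close> is what produces the point value
  \<open>u a\<close>.\<close>

definition exp_tail :: "real \<Rightarrow> real \<Rightarrow> real \<Rightarrow> real" where
  "exp_tail s a x = indicator {a<..} x * exp (- s * (x - a))"

lemma exp_tail_measurable [measurable]: "exp_tail s a \<in> borel_measurable borel"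
  unfolding exp_tail_def by measurable

lemma exp_tail_square_integral:
  assumes "s > 0"
  shows "has_bochner_integral lborel (\<lambda>x. (exp_tail s a x)\<^sup>2) (1 / (2 * s))"
proof (rule has_bochner_integral_nn_integral)
  have "filterlim (\<lambda>x. - (2 * s) * (x - a)) at_bot at_top"
    using assms filterlim_tendsto_add_at_top[OF tendsto_const filterlim_ident, of "- a"]
    by (intro filterlim_tendsto_neg_mult_at_bot[OF tendsto_const]) auto
  then have "((\<lambda>x. - exp (- (2 * s) * (x - a)) / (2 * s)) \<longlongrightarrow> - 0 / (2 * s)) at_top"
    using assms by (intro tendsto_intros filterlim_compose[OF exp_at_bot]) auto
  then have "((\<lambda>x. - exp (- (2 * s) * (x - a)) / (2 * s)) \<longlongrightarrow> 0) at_top"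
    by simp
  then have "(\<integral>\<^sup>+x. ennreal (exp (- (2 * s) * (x - a))) * indicator {a..} x \<partial>lborel)
      = 0 - (- exp (- (2 * s) * (a - a)) / (2 * s))"
    using assms
    by (intro nn_integral_FTC_atLeast) (auto intro!: derivative_eq_intros simp: field_simps)
  also have "(\<integral>\<^sup>+x. ennreal (exp (- (2 * s) * (x - a))) * indicator {a..} x \<partial>lborel)
      = (\<integral>\<^sup>+x. ennreal ((exp_tail s a x)\<^sup>2) \<partial>lborel)"
  \<comment> \<open>The fundamental theorem is applied on the closed half-line while the tail lives
    on the open one; they differ only at \<open>a\<close>.\<close>
  proof (rule nn_integral_cong_AE)
    show "AE x in lborel. ennreal (exp (- (2 * s) * (x - a))) * indicator {a..} x
        = ennreal ((exp_tail s a x)\<^sup>2)"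
      using AE_lborel_singleton[of a]
      by eventually_elim
        (auto simp: exp_tail_def indicator_def power2_eq_square field_simps simp flip: exp_add)
  qed
  finally show "(\<integral>\<^sup>+x. ennreal ((exp_tail s a x)\<^sup>2) \<partial>lborel) = ennreal (1 / (2 * s))"
    by simp
qed (use assms in auto)

lemma L2_exp_tail: "s > 0 \<Longrightarrow> L2 (exp_tail s a)"
  using exp_tail_square_integral[of s a] by (auto simp: L2_def has_bochner_integral_iff)

lemma test_fun_iff: "test_fun f \<longleftrightarrow> smooth f \<and> (\<exists>R. \<forall>x. \<bar>x\<bar> > R \<longrightarrow> f x = 0)"
  by (simp add: test_fun_def smooth_def)

text \<open>Serves to carry estimates from the right half-line to the left one. Testing with the
  reflected function \<open>\<psi>\<close> changes the sign of the derivative once, whence the minus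
  sign in front of \<open>g\<close>.\<close>

lemma weak_deriv_reflect:
  assumes "weak_deriv_L2 u g"
  shows "weak_deriv_L2 (\<lambda>x. u (- x)) (\<lambda>x. - g (- x))"
proof -
  have L2: "L2 (\<lambda>x. f (- x))" if "L2 f" for f
  proof -
    note [measurable] = L2_measurable[OF that]
    show ?thesis
      using lborel_integrable_real_affine[OF L2_integrable[OF that], of "-1" 0]
      by (simp add: L2_def)
  qed
  have L2m: "L2 (\<lambda>x. - f x)" if "L2 f" for f
    using that by (simp add: L2_def)
  have "(LINT x|lborel. u (- x) * deriv \<phi> x) = - (LINT x|lborel. - g (- x) * \<phi> x)"
    if \<phi>: "test_fun \<phi>" for \<phi>
  proof -
    define \<psi> where "\<psi> x = \<phi> (- x)" for x
    have "smooth \<psi>"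
      using \<phi> smooth_affine[of \<phi> 1 "-1" 0] by (simp add: test_fun_iff \<psi>_def[abs_def])
    moreover have "\<exists>R. \<forall>x. \<bar>x\<bar> > R \<longrightarrow> \<psi> x = 0"
      using \<phi> unfolding test_fun_iff \<psi>_def by (metis abs_minus_cancel)
    ultimately have "(LINT x|lborel. u x * deriv \<psi> x) = - (LINT x|lborel. g x * \<psi> x)"
      using assms by (simp add: weak_deriv_L2_def test_fun_iff)
    moreover have "deriv \<psi> x = - deriv \<phi> (- x)" for x
    proof -
      have "(\<psi> has_field_derivative deriv \<phi> (- x) * - 1) (at x)"
        unfolding \<psi>_def[abs_def]
        by (rule DERIV_chain2[OF smooth_DERIV]) (use \<phi> in \<open>auto simp: test_fun_iff intro!: derivative_eq_intros\<close>)
      then show ?thesis by (simp add: DERIV_imp_deriv)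
    qed
    ultimately have "(LINT x|lborel. u x * deriv \<phi> (- x)) = (LINT x|lborel. g x * \<phi> (- x))"
      by (simp add: \<psi>_def)
    then show ?thesis
      using lborel_integral_real_affine[of "-1" "\<lambda>x. u x * deriv \<phi> (- x)" 0]
        lborel_integral_real_affine[of "-1" "\<lambda>x. g x * \<phi> (- x)" 0] by simp
  qed
  then show ?thesis
    using assms L2 L2m[OF L2] by (auto simp: weak_deriv_L2_def)
qed

text \<open>
  \<open>\<phi> n\<close> approximates the tail, and its derivative splits into a part concentrating at \<open>a\<close>
  with total mass tending to 1, the part \<open>- s \<phi> n\<close>, and a vanishing part from the cutoff at
  infinity.
\<close>

lemma exp_tail_cutoff:
  assumes s: "s > 0"
  obtains \<phi> \<rho> \<kappa> :: "nat \<Rightarrow> real \<Rightarrow> real" and \<eta> :: "real \<Rightarrow> real" and M where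
    "\<And>n. test_fun (\<phi> n)"
    "\<And>n x. deriv (\<phi> n) x = real (Suc n) * \<rho> n (real (Suc n) * (x - a)) - s * \<phi> n x - \<kappa> n x"
    "\<And>n x. \<bar>\<phi> n x\<bar> \<le> exp_tail s a x" "\<And>x. (\<lambda>n. \<phi> n x) \<longlonglongrightarrow> exp_tail s a x"
    "\<And>n x. \<bar>\<kappa> n x\<bar> \<le> M * exp_tail s a x" "\<And>x. (\<lambda>n. \<kappa> n x) \<longlonglongrightarrow> 0"
    "\<And>n x. \<bar>\<rho> n x\<bar> \<le> M * indicator {0..1} x" "\<And>x. (\<lambda>n. \<rho> n x) \<longlonglongrightarrow> \<eta> x"
    "\<And>n. \<phi> n \<in> borel_measurable borel" "\<And>n. \<kappa> n \<in> borel_measurable borel"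
    "\<And>n. \<rho> n \<in> borel_measurable borel" "\<eta> \<in> borel_measurable borel"
    "(LINT y|lborel. \<eta> y) = 1"
proof (rule smooth_step_exists)
  fix H assume H: "smooth H" "\<And>x. x \<le> 0 \<Longrightarrow> H x = 0" "\<And>x. x \<ge> 1 \<Longrightarrow> H x = 1"
    "\<And>x. x \<le> 0 \<or> x \<ge> 1 \<Longrightarrow> deriv H x = 0" "\<And>x. 0 \<le> H x" "\<And>x. H x \<le> 1"
  note contH = smooth_continuous[OF H(1), of UNIV]
  note contD = smooth_continuous[OF smooth_deriv[OF H(1)], of UNIV]
  note [measurable] = borel_measurable_continuous_onI[OF contH] borel_measurable_continuous_onI[OF contD]
  have "compact (deriv H ` {0..1})"
    by (intro compact_continuous_image smooth_continuous smooth_deriv H) auto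
  then obtain M where M: "\<And>x. x \<in> {0..1} \<Longrightarrow> \<bar>deriv H x\<bar> \<le> M"
    by (fastforce dest!: compact_imp_bounded simp: bounded_iff)
  have M0: "0 \<le> M" using M[of 0] by auto
  have M: "\<bar>deriv H x\<bar> \<le> M * indicator {0..1} x" for x
    using M[of x] H(4)[of x] by (auto simp: indicator_def)
  have M': "\<bar>deriv H x\<bar> \<le> M" for x
    using M[of x] M0 by (cases "x \<in> {0..1}") auto
  define N where "N n = real (Suc n)" for n
  have N: "N n \<ge> 1" for n by (simp add: N_def)
  have N_large: "\<forall>\<^sub>F n in sequentially. c \<le> N n" for c
    unfolding N_def using eventually_ge_at_top[of "nat \<lceil>c\<rceil>"] by eventually_elim linarith
  \<comment> \<open>The first factor switches on across \<open>[a, a + 1 / N n]\<close>, the last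
    one switches off across \<open>[N n - 1, N n]\<close>. Differentiating the first factor gives
    \<open>\<rho>\<close>, written in the variable \<open>y = N n (x - a)\<close> so that its
    support stays in \<open>[0, 1]\<close>.\<close>
  define \<phi> where "\<phi> n x = H (N n * (x - a)) * exp (- s * (x - a)) * H (N n - x)" for n x
  define \<rho> where "\<rho> n y = deriv H y * exp (- s * (y / N n)) * H (N n - (a + y / N n))" for n y
  define \<kappa> where "\<kappa> n x = H (N n * (x - a)) * exp (- s * (x - a)) * deriv H (N n - x)" for n x
  \<comment> \<open>For \<open>x \<le> a\<close> the argument of \<open>H\<close> is nonpositive;
    the explicit indicator lets the product be compared with \<open>exp_tail\<close>.\<close>
  have H_pos: "H (N n * (x - a)) = indicator {a<..} x * H (N n * (x - a))" for n x
    using N[of n] by (auto simp: indicator_def intro!: H(2) mult_nonneg_nonpos)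
  show thesis
  proof
    show "test_fun (\<phi> n)" for n
    proof -
      have 1: "smooth (\<lambda>x. H (N n * (x - a)))"
        using smooth_affine[OF H(1), of 1 "N n" "- N n * a"] by (simp add: algebra_simps)
      have 2: "smooth (\<lambda>x. exp (- s * (x - a)))"
        using smooth_affine[OF smooth_exp, of 1 "- s" "s * a"] by (simp add: algebra_simps)
      have 3: "smooth (\<lambda>x. H (N n - x))"
        using smooth_affine[OF H(1), of 1 "- 1" "N n"] by (simp add: algebra_simps)
      have "smooth (\<phi> n)"
        unfolding \<phi>_def by (intro smooth_mult 1 2 3)
      moreover have "\<phi> n x = 0" if "\<bar>x\<bar> > \<bar>a\<bar> + N n" for x
      proof (cases "x > 0")
        case True
        then have "N n - x \<le> 0" using that by auto
        then show ?thesis by (simp add: \<phi>_def H(2))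
      next
        case False
        then have "\<not> a < x" using that N[of n] by auto
        then show ?thesis by (subst \<phi>_def, subst H_pos) auto
      qed
      ultimately show ?thesis by (auto simp: test_fun_iff)
    qed
    show "deriv (\<phi> n) x = real (Suc n) * \<rho> n (real (Suc n) * (x - a)) - s * \<phi> n x - \<kappa> n x" for n x
    proof (rule DERIV_imp_deriv)
      have *: "(\<phi> n has_field_derivative
          (deriv H (N n * (x - a)) * N n) * exp (- s * (x - a)) * H (N n - x)
          + H (N n * (x - a)) * (exp (- s * (x - a)) * - s) * H (N n - x)
          + H (N n * (x - a)) * exp (- s * (x - a)) * (deriv H (N n - x) * - 1)) (at x)"
        unfolding \<phi>_def[abs_def]
        by (auto intro!: derivative_eq_intros DERIV_chain2[OF smooth_DERIV[OF H(1)]] simp: algebra_simps)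
      have "N n * (x - a) / N n = x - a" using N[of n] by simp
      then have eq: "\<rho> n (N n * (x - a)) = deriv H (N n * (x - a)) * exp (- s * (x - a)) * H (N n - x)"
        by (simp add: \<rho>_def)
      show "(\<phi> n has_field_derivative real (Suc n) * \<rho> n (real (Suc n) * (x - a)) - s * \<phi> n x - \<kappa> n x) (at x)"
        by (rule DERIV_cong[OF *], unfold N_def[symmetric] eq)
          (simp add: \<phi>_def \<kappa>_def algebra_simps)
    qed
    have Hle: "\<bar>H (N n * (x - a)) * exp (- s * (x - a))\<bar> \<le> exp_tail s a x" for n x
    proof (subst H_pos)
      have "\<bar>H (N n * (x - a))\<bar> \<le> 1" using H(5,6) by simp
      then have "\<bar>H (N n * (x - a))\<bar> * (indicator {a<..} x * exp (- s * (x - a))) \<le> 1 * exp_tail s a x"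
        unfolding exp_tail_def by (intro mult_right_mono) auto
      then show "\<bar>indicator {a<..} x * H (N n * (x - a)) * exp (- s * (x - a))\<bar> \<le> exp_tail s a x"
        by (simp add: abs_mult mult_ac)
    qed
    have et: "exp_tail s a x \<ge> 0" for x by (simp add: exp_tail_def)
    show "\<bar>\<phi> n x\<bar> \<le> exp_tail s a x" for n x
    proof -
      have "\<bar>\<phi> n x\<bar> \<le> exp_tail s a x * 1"
        unfolding \<phi>_def by (subst abs_mult, rule mult_mono[OF Hle]) (use H(5,6) et in auto)
      then show ?thesis by simp
    qed
    show "\<bar>\<kappa> n x\<bar> \<le> M * exp_tail s a x" for n x
    proof -
      have "\<bar>\<kappa> n x\<bar> \<le> exp_tail s a x * M"
        unfolding \<kappa>_def by (subst abs_mult, rule mult_mono[OF Hle]) (use M' et in auto)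
      then show ?thesis by (simp add: mult.commute)
    qed
    show "(\<lambda>n. \<phi> n x) \<longlonglongrightarrow> exp_tail s a x" for x
    proof (cases "x > a")
      case True
      have "\<forall>\<^sub>F n in sequentially. \<phi> n x = exp_tail s a x"
        using N_large[of "1 / (x - a)"] N_large[of "x + 1"]
      proof eventually_elim
        case (elim n)
        then have "N n * (x - a) \<ge> 1" "N n - x \<ge> 1"
          using True by (auto simp: field_simps)
        then show ?case using True by (simp add: \<phi>_def exp_tail_def H(3))
      qed
      then show ?thesis by (rule tendsto_eventually)
    next
      case False
      then have "\<phi> n x = exp_tail s a x" for n
        by (subst \<phi>_def, subst H_pos) (auto simp: exp_tail_def)
      then show ?thesis by simp
    qed
    show "(\<lambda>n. \<kappa> n x) \<longlonglongrightarrow> 0" for x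
    proof (rule tendsto_eventually)
      show "\<forall>\<^sub>F n in sequentially. \<kappa> n x = 0"
        using N_large[of "x + 1"] by eventually_elim (simp add: \<kappa>_def H(4))
    qed
    show "\<bar>\<rho> n x\<bar> \<le> M * indicator {0..1} x" for n x
    proof (cases "x \<in> {0..1}")
      case True
      then have "exp (- s * (x / N n)) \<le> 1" using s N[of n] by simp
      then have "\<bar>deriv H x\<bar> * exp (- s * (x / N n)) * H (N n - (a + x / N n)) \<le> M * 1 * 1"
        using M'[of x] H(5,6) M0 by (intro mult_mono) auto
      then show ?thesis using True H(5) by (simp add: \<rho>_def abs_mult)
    next
      case False
      then have "deriv H x = 0" by (intro H(4)) auto
      with False show ?thesis by (simp add: \<rho>_def)
    qed
    \<comment> \<open>The limit kernel \<open>\<eta>\<close> is \<open>deriv H\<close>: for fixed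
      \<open>y\<close> the point \<open>a + y / N n\<close> tends to \<open>a\<close>, so the
      exponential tends to 1 and the outer cutoff is eventually 1.\<close>
    show "(\<lambda>n. \<rho> n y) \<longlonglongrightarrow> deriv H y" for y
    proof (cases "y \<in> {0..1}")
      case True
      have "\<forall>\<^sub>F n in sequentially. H (N n - (a + y / N n)) = 1"
        using N_large[of "a + 2"]
      proof eventually_elim
        case (elim n)
        have "y / N n \<le> 1" using True N[of n] by (simp add: field_simps)
        then show ?case using elim by (intro H(3)) auto
      qed
      then have 1: "(\<lambda>n. H (N n - (a + y / N n))) \<longlonglongrightarrow> 1" by (rule tendsto_eventually)
      have "filterlim N at_top sequentially"
        using filterlim_at_top[of N sequentially] N_large by blast
      then have "(\<lambda>n. y / N n) \<longlonglongrightarrow> 0"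
        by (rule real_tendsto_divide_at_top[OF tendsto_const])
      then have "(\<lambda>n. \<rho> n y) \<longlonglongrightarrow> deriv H y * exp (- s * 0) * 1"
        unfolding \<rho>_def by (intro tendsto_mult[OF _ 1] tendsto_intros)
      then show ?thesis by simp
    next
      case False
      then have "deriv H y = 0" by (intro H(4)) auto
      then show ?thesis by (simp add: \<rho>_def)
    qed
    show "\<phi> n \<in> borel_measurable borel" "\<kappa> n \<in> borel_measurable borel"
      "\<rho> n \<in> borel_measurable borel" "deriv H \<in> borel_measurable borel" for n
      unfolding \<phi>_def \<kappa>_def \<rho>_def by measurable
    \<comment> \<open>The total mass of the kernel is the height of the step.\<close>
    have "(LINT x|lborel. deriv H x * indicator {0..1} x) = H 1 - H 0"
    proof (rule integral_FTC_Icc_real)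
      show "isCont (deriv H) x" for x
        using contD by (simp add: continuous_on_eq_continuous_at)
    qed (simp_all add: smooth_DERIV[OF H(1)])
    also have "(\<lambda>x. deriv H x * indicator {0..1} x) = deriv H"
    proof
      show "deriv H x * indicator {0..1} x = deriv H x" for x
        using H(4)[of x] by (cases "x \<in> {0..1}") auto
    qed
    finally show "(LINT y|lborel. deriv H y) = 1"
      using H(2)[of 0] H(3)[of 1] by simp
  qed
qed

text \<open>The equation for the tail is tested against \<open>u\<close> through its smooth cutoffs.
  Continuity of \<open>u\<close> makes the concentrating part converge to \<open>u a\<close>;
  dominated convergence handles the other terms.\<close>

lemma weak_deriv_representation:
  assumes wd: "weak_deriv_L2 u g" and cont: "continuous_on UNIV u" and s: "s > 0"
  shows "u a = (LINT x|lborel. exp_tail s a x * (s * u x - g x))"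
proof (rule exp_tail_cutoff[OF s, of a])
  have L2: "L2 u" "L2 g" using wd by (auto simp: weak_deriv_L2_def)
  note [measurable] = L2_measurable[OF L2(1)] L2_measurable[OF L2(2)]
  fix \<phi> \<rho> \<kappa> :: "nat \<Rightarrow> real \<Rightarrow> real" and \<eta> :: "real \<Rightarrow> real" and M
  assume
    test: "\<And>n. test_fun (\<phi> n)" and
    deriv: "\<And>n x. deriv (\<phi> n) x = real (Suc n) * \<rho> n (real (Suc n) * (x - a)) - s * \<phi> n x - \<kappa> n x" and
    \<phi>: "\<And>n x. \<bar>\<phi> n x\<bar> \<le> exp_tail s a x" "\<And>x. (\<lambda>n. \<phi> n x) \<longlonglongrightarrow> exp_tail s a x" and
    \<kappa>: "\<And>n x. \<bar>\<kappa> n x\<bar> \<le> M * exp_tail s a x" "\<And>x. (\<lambda>n. \<kappa> n x) \<longlonglongrightarrow> 0" and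
    \<rho>: "\<And>n x. \<bar>\<rho> n x\<bar> \<le> M * indicator {0..1} x" "\<And>x. (\<lambda>n. \<rho> n x) \<longlonglongrightarrow> \<eta> x" and
    meas [measurable]: "\<And>n. \<phi> n \<in> borel_measurable borel" "\<And>n. \<kappa> n \<in> borel_measurable borel"
      "\<And>n. \<rho> n \<in> borel_measurable borel" "\<eta> \<in> borel_measurable borel" and
    int\<eta>: "(LINT y|lborel. \<eta> y) = 1"
  define N where "N n = real (Suc n)" for n
  have N: "N n \<ge> 1" for n by (simp add: N_def)
  have "filterlim N at_top sequentially"
    unfolding N_def by (rule filterlim_compose[OF filterlim_real_sequentially filterlim_Suc])
  then have N0: "(\<lambda>n. y / N n) \<longlonglongrightarrow> 0" for y
    by (rule real_tendsto_divide_at_top[OF tendsto_const])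
  have tail_int: "integrable lborel (\<lambda>x. \<bar>f x\<bar> * exp_tail s a x)" if "L2 f" for f
    using that L2_exp_tail[OF s] by (intro L2_mult_integrable) (auto simp: L2_def)
  have M0: "0 \<le> M" using \<rho>(1)[of 0 0] by auto
  \<comment> \<open>For \<open>y\<close> in \<open>[0, 1]\<close> and \<open>N n \<ge> 1\<close> the
    point \<open>a + y / N n\<close> stays in \<open>[a, a + 1]\<close>, so a bound for
    \<open>u\<close> there dominates the concentrating part.\<close>
  have "compact (u ` {a..a+1})"
    by (intro compact_continuous_image continuous_on_subset[OF cont]) auto
  then obtain K where K: "\<And>x. x \<in> {a..a+1} \<Longrightarrow> \<bar>u x\<bar> \<le> K"
    by (fastforce dest!: compact_imp_bounded simp: bounded_iff)
  have K0: "0 \<le> K" using K[of a] by auto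

  have A_bound: "norm (u (a + y / N n) * \<rho> n y) \<le> K * (M * indicator {0..1} y)" for n y
  proof (cases "y \<in> {0..1}")
    case True
    then have "\<bar>u (a + y / N n)\<bar> \<le> K"
      using N[of n] by (intro K) (auto simp: field_simps)
    then show ?thesis
      using \<rho>(1)[of n y] K0 by (auto simp: abs_mult intro!: mult_mono)
  next
    case False
    then show ?thesis using \<rho>(1)[of n y] by simp
  qed
  have A_dom: "integrable lborel (\<lambda>y::real. K * (M * indicator {0..1} y))"
    by (intro integrable_mult_right integrable_real_indicator) simp_all
  have A_lim: "(\<lambda>n. u (a + y / N n) * \<rho> n y) \<longlonglongrightarrow> u a * \<eta> y" for y
  proof (rule tendsto_mult[OF _ \<rho>(2)])
    have "isCont u (a + 0)" using cont by (simp add: continuous_on_eq_continuous_at)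
    then show "(\<lambda>n. u (a + y / N n)) \<longlonglongrightarrow> u a"
      using isCont_tendsto_compose[of "a + 0" u "\<lambda>n. a + y / N n" sequentially]
        tendsto_add[OF tendsto_const N0[of y], of a] by simp
  qed
  have A_int: "integrable lborel (\<lambda>y. u (a + y / N n) * \<rho> n y)" for n
    by (rule Bochner_Integration.integrable_bound[OF A_dom]) (use A_bound in \<open>auto intro: order_trans[OF _ abs_ge_self]\<close>)
  have A: "(\<lambda>n. LINT y|lborel. u (a + y / N n) * \<rho> n y) \<longlonglongrightarrow> (LINT y|lborel. u a * \<eta> y)"
    by (rule integral_dominated_convergence[OF _ _ A_dom]) (use A_lim A_bound in auto)
  \<comment> \<open>Substituting \<open>x = a + y / N n\<close>, the Jacobian cancels the factor
    \<open>N n\<close>.\<close>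
  have A_eq: "(LINT x|lborel. u x * (N n * \<rho> n (N n * (x - a)))) = (LINT y|lborel. u (a + y / N n) * \<rho> n y)" for n
    using lborel_integral_real_affine[of "1 / N n" "\<lambda>x. u x * (N n * \<rho> n (N n * (x - a)))" a] N[of n]
    by (simp add: mult.left_commute[of "u _"])
  have A_int': "integrable lborel (\<lambda>x. u x * (N n * \<rho> n (N n * (x - a))))" for n
    using lborel_integrable_real_affine_iff[of "1 / N n" "\<lambda>x. u x * (N n * \<rho> n (N n * (x - a)))" a] N[of n] A_int[of n]
    by (simp add: mult.left_commute[of "u _"])

  have cut: "integrable lborel (\<lambda>x. f x * \<phi> n x)"
    "(\<lambda>n. LINT x|lborel. f x * \<phi> n x) \<longlonglongrightarrow> (LINT x|lborel. f x * exp_tail s a x)"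
    if f: "L2 f" for f n
  proof -
    note [measurable] = L2_measurable[OF f]
    have bound: "norm (f x * \<phi> n x) \<le> \<bar>f x\<bar> * exp_tail s a x" for n x
      using \<phi>(1)[of n x] by (auto simp: abs_mult intro!: mult_left_mono)
    show "integrable lborel (\<lambda>x. f x * \<phi> n x)"
      by (rule Bochner_Integration.integrable_bound[OF tail_int[OF f]])
        (use bound in \<open>auto intro: order_trans[OF _ abs_ge_self]\<close>)
    show "(\<lambda>n. LINT x|lborel. f x * \<phi> n x) \<longlonglongrightarrow> (LINT x|lborel. f x * exp_tail s a x)"
      by (rule integral_dominated_convergence[OF _ _ tail_int[OF f]])
        (use bound in \<open>auto intro!: tendsto_intros \<phi>(2)\<close>)
  qed

  have C_bound: "norm (u x * \<kappa> n x) \<le> M * (\<bar>u x\<bar> * exp_tail s a x)" for n x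
    using mult_left_mono[OF \<kappa>(1)[of n x], of "\<bar>u x\<bar>"] by (simp add: abs_mult mult_ac)
  have C_dom: "integrable lborel (\<lambda>x. M * (\<bar>u x\<bar> * exp_tail s a x))"
    by (intro integrable_mult_right tail_int L2)
  have C_int: "integrable lborel (\<lambda>x. u x * \<kappa> n x)" for n
    by (rule Bochner_Integration.integrable_bound[OF C_dom])
      (use C_bound in \<open>auto intro: order_trans[OF _ abs_ge_self]\<close>)
  \<comment> \<open>The error from the cutoff at infinity disappears in the limit.\<close>
  have C: "(\<lambda>n. LINT x|lborel. u x * \<kappa> n x) \<longlonglongrightarrow> (LINT x|lborel. u x * 0)"
    by (rule integral_dominated_convergence[OF _ _ C_dom])
      (use C_bound \<kappa>(2) in \<open>auto intro!: tendsto_mult_right_zero\<close>)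

  have "(LINT x|lborel. u x * deriv (\<phi> n) x) =
      (LINT y|lborel. u (a + y / N n) * \<rho> n y) - s * (LINT x|lborel. u x * \<phi> n x) - (LINT x|lborel. u x * \<kappa> n x)" for n
  proof -
    have "(LINT x|lborel. u x * deriv (\<phi> n) x) =
        (LINT x|lborel. u x * (N n * \<rho> n (N n * (x - a))) - s * (u x * \<phi> n x) - u x * \<kappa> n x)"
      unfolding deriv N_def[symmetric] by (rule Bochner_Integration.integral_cong) (simp_all add: algebra_simps)
    then show ?thesis
      using A_int'[of n] cut(1)[OF L2(1), of n] C_int[of n] A_eq[of n]
      by simp
  qed
  moreover have "(LINT x|lborel. u x * deriv (\<phi> n) x) = - (LINT x|lborel. g x * \<phi> n x)" for n
    using wd test by (auto simp: weak_deriv_L2_def)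
  \<comment> \<open>The limits of the three pieces are combined; comparing with the limit of the
    right-hand side then determines \<open>u a\<close>.\<close>
  ultimately have "(\<lambda>n. - (LINT x|lborel. g x * \<phi> n x)) \<longlonglongrightarrow>
      (LINT y|lborel. u a * \<eta> y) - s * (LINT x|lborel. u x * exp_tail s a x) - (LINT x|lborel. u x * 0)"
    using tendsto_diff[OF tendsto_diff[OF A tendsto_mult[OF tendsto_const cut(2)[OF L2(1)]]] C, of s]
    by simp
  then have "- (LINT x|lborel. g x * exp_tail s a x) =
      (LINT y|lborel. u a * \<eta> y) - s * (LINT x|lborel. u x * exp_tail s a x) - (LINT x|lborel. u x * 0)"
    using LIMSEQ_unique tendsto_minus[OF cut(2)[OF L2(2)]] by blast
  then have "u a = s * (LINT x|lborel. u x * exp_tail s a x) - (LINT x|lborel. g x * exp_tail s a x)"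
    using int\<eta> by simp
  also have "\<dots> = (LINT x|lborel. exp_tail s a x * (s * u x - g x))"
    using L2_mult_integrable[OF L2(1) L2_exp_tail[OF s]] L2_mult_integrable[OF L2(2) L2_exp_tail[OF s]]
    by (simp add: right_diff_distrib mult.left_commute[of _ s] mult.commute[of "exp_tail s a _"] mult.assoc)
  finally show ?thesis .
qed

section \<open>Sharp energy bounds at a point\<close>

text \<open>Expanding the nonnegative integral of \<open>(s u - t w)^2 + (g + t w)^2\<close> over
  \<open>x > a\<close> leaves the energy, \<open>t^2 / s\<close>, and a cross term that the
  representation evaluates as \<open>- 2 t u(a)\<close>.\<close>

lemma half_line_energy_bound:
  assumes wd: "weak_deriv_L2 u g" and cont: "continuous_on UNIV u" and s: "s > 0"
  shows "s * (u a)\<^sup>2 \<le> (LINT x|lborel. indicator {a<..} x * ((g x)\<^sup>2 + s\<^sup>2 * (u x)\<^sup>2))"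
proof -
  have L2: "L2 u" "L2 g" using wd by (auto simp: weak_deriv_L2_def)
  \<comment> \<open>The value of \<open>t\<close> that maximises the resulting lower bound
    \<open>2 t u(a) - t^2 / s\<close>.\<close>
  define t where "t = s * u a"
  let ?w = "exp_tail s a"
  have iw: "integrable lborel (\<lambda>x. (?w x)\<^sup>2)" "(LINT x|lborel. (?w x)\<^sup>2) = 1 / (2 * s)"
    using exp_tail_square_integral[OF s, of a] by (auto simp: has_bochner_integral_iff)
  have ir: "integrable lborel (\<lambda>x. ?w x * (s * u x - g x))"
    using L2_mult_integrable[OF L2_exp_tail[OF s] L2(1)] L2_mult_integrable[OF L2_exp_tail[OF s] L2(2)]
    by (simp add: right_diff_distrib mult.left_commute[of _ s])
  have ie: "integrable lborel (\<lambda>x. indicator {a<..} x * ((g x)\<^sup>2 + s\<^sup>2 * (u x)\<^sup>2))"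
    using integrable_mult_indicator[of "{a<..}" lborel "\<lambda>x. (g x)\<^sup>2 + s\<^sup>2 * (u x)\<^sup>2"] L2
    by (auto simp: L2_def)
  have "s * (u a)\<^sup>2 = 2 * t * u a - 2 * t\<^sup>2 * (1 / (2 * s))"
    using s by (simp add: t_def power2_eq_square)
  also have "\<dots> = (LINT x|lborel. 2 * t * (?w x * (s * u x - g x)) - 2 * t\<^sup>2 * (?w x)\<^sup>2)"
    using iw ir weak_deriv_representation[OF wd cont s, of a] by simp
  also have "\<dots> \<le> (LINT x|lborel. indicator {a<..} x * ((g x)\<^sup>2 + s\<^sup>2 * (u x)\<^sup>2))"
  proof (rule integral_mono)
    fix x
    have "0 \<le> (s * u x - t * exp (- s * (x - a)))\<^sup>2 + (g x + t * exp (- s * (x - a)))\<^sup>2"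
      by simp
    then show "2 * t * (?w x * (s * u x - g x)) - 2 * t\<^sup>2 * (?w x)\<^sup>2
        \<le> indicator {a<..} x * ((g x)\<^sup>2 + s\<^sup>2 * (u x)\<^sup>2)"
      by (cases "a < x") (auto simp: exp_tail_def power2_eq_square algebra_simps)
  qed (use iw ir ie in auto)
  finally show ?thesis .
qed

lemma energy_bound:
  assumes wd: "weak_deriv_L2 u g" and cont: "continuous_on UNIV u" and s: "s > 0"
  shows "2 * s * (u a)\<^sup>2 \<le> (LINT x|lborel. (g x)\<^sup>2 + s\<^sup>2 * (u x)\<^sup>2)"
proof -
  let ?e = "\<lambda>x. (g x)\<^sup>2 + s\<^sup>2 * (u x)\<^sup>2"
  have int: "integrable lborel ?e"
    using wd by (auto simp: weak_deriv_L2_def L2_def)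
  have int': "integrable lborel (\<lambda>x. indicator A x * ?e x)" if "A \<in> sets borel" for A
    using integrable_mult_indicator[of A lborel ?e] int that by simp
  have "continuous_on UNIV (\<lambda>x. u (- x))"
    by (intro continuous_on_compose2[OF cont] continuous_intros) auto
  \<comment> \<open>The reflected function has the value \<open>u a\<close> at \<open>- a\<close>,
    and its right half-line there is the left half-line of \<open>u\<close> at
    \<open>a\<close>.\<close>
  from half_line_energy_bound[OF weak_deriv_reflect[OF wd] this s, of "- a"]
  have "s * (u a)\<^sup>2 \<le> (LINT x|lborel. indicator {- a<..} x * ?e (- x))"
    by simp
  also have "\<dots> = (LINT x|lborel. indicator {..<a} x * ?e x)"
    using lborel_integral_real_affine[of "-1" "\<lambda>x. indicator {..<a} x * ?e x" 0]
    by (simp add: indicator_def minus_less_iff[of a])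
  finally have "2 * s * (u a)\<^sup>2 \<le> (LINT x|lborel. indicator {..<a} x * ?e x) + (LINT x|lborel. indicator {a<..} x * ?e x)"
    using half_line_energy_bound[OF wd cont s, of a] by simp
  also have "\<dots> = (LINT x|lborel. indicator {..<a} x * ?e x + indicator {a<..} x * ?e x)"
    by (intro Bochner_Integration.integral_add[symmetric] int') auto
  also have "\<dots> \<le> (LINT x|lborel. ?e x)"
    by (intro integral_mono Bochner_Integration.integrable_add int int') (auto simp: indicator_def)
  finally show ?thesis .
qed

subsection \<open>Uniqueness, sup norm and extremals\<close>

lemma L2_compact_support:
  assumes "continuous_on UNIV f" and "\<And>x. \<bar>x\<bar> > R \<Longrightarrow> f x = 0"
  shows "L2 f"
proof -
  have "integrable lborel (\<lambda>x. indicator {- R..R} x *\<^sub>R (f x)\<^sup>2)"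
    by (intro borel_integrable_compact continuous_intros continuous_on_subset[OF assms(1)]) auto
  also have "(\<lambda>x. indicator {- R..R} x *\<^sub>R (f x)\<^sup>2) = (\<lambda>x. (f x)\<^sup>2)"
  proof
    show "indicator {- R..R} x *\<^sub>R (f x)\<^sup>2 = (f x)\<^sup>2" for x
      using assms(2)[of x] by (cases "\<bar>x\<bar> > R") (auto simp: indicator_def not_less abs_le_iff)
  qed
  finally show ?thesis
    using borel_measurable_continuous_onI[OF assms(1)] by (simp add: L2_def)
qed

lemma test_fun_deriv:
  assumes "test_fun \<phi>"
  shows "test_fun (deriv \<phi>)"
proof -
  obtain R where R: "\<And>x. \<bar>x\<bar> > R \<Longrightarrow> \<phi> x = 0"
    using assms by (auto simp: test_fun_iff)
  have "deriv \<phi> x = 0" if "\<bar>x\<bar> > R" for x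
  proof (rule DERIV_imp_deriv, rule has_field_derivative_transform_within_open)
    show "((\<lambda>x. 0) has_field_derivative 0) (at x)" by simp
    show "open {x. \<bar>x\<bar> > R}" by (intro open_Collect_less continuous_intros)
  qed (use that R in auto)
  then show ?thesis
    using assms smooth_deriv by (auto simp: test_fun_iff)
qed

lemma test_fun_L2: "test_fun \<phi> \<Longrightarrow> L2 \<phi>"
  using L2_compact_support smooth_continuous by (metis test_fun_iff)

text \<open>The difference \<open>d\<close> is a weak derivative of the zero function, so by the
  representation with \<open>s = 1\<close> the integral of \<open>exp (- x) d x\<close> over every
  ray \<open>x > a\<close> is zero. Rays determine a measure, which forces \<open>d = 0\<close>
  almost everywhere.\<close>

lemma weak_deriv_unique:
  assumes g: "weak_deriv_L2 u g" and h: "weak_deriv_L2 u h"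
  shows "AE x in lborel. g x = h x"
proof -
  define d where "d x = g x - h x" for x
  have L2: "L2 g" "L2 h" using g h by (auto simp: weak_deriv_L2_def)
  note [measurable] = L2_measurable[OF L2(1)] L2_measurable[OF L2(2)]
  have [measurable]: "d \<in> borel_measurable borel" unfolding d_def by measurable
  have "integrable lborel (\<lambda>x. (g x)\<^sup>2 + (h x)\<^sup>2 - 2 * (g x * h x))"
    using L2 L2_mult_integrable[OF L2] by (auto simp: L2_def)
  then have L2d: "L2 d"
    by (simp add: L2_def d_def power2_diff mult.assoc)
  have "weak_deriv_L2 (\<lambda>x. 0) d"
    unfolding weak_deriv_L2_def
  proof (intro conjI allI impI L2d)
    fix \<phi> assume \<phi>: "test_fun \<phi>"
    have "L2 \<phi>" using test_fun_L2[OF \<phi>] .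
    have "(LINT x|lborel. d x * \<phi> x) = (LINT x|lborel. g x * \<phi> x) - (LINT x|lborel. h x * \<phi> x)"
      unfolding d_def left_diff_distrib
      by (intro Bochner_Integration.integral_diff L2_mult_integrable L2 \<open>L2 \<phi>\<close>)
    also have "\<dots> = 0"
    proof -
      have "(LINT x|lborel. u x * deriv \<phi> x) = - (LINT x|lborel. g x * \<phi> x)"
        "(LINT x|lborel. u x * deriv \<phi> x) = - (LINT x|lborel. h x * \<phi> x)"
        using g h \<phi> by (simp_all add: weak_deriv_L2_def)
      then show ?thesis by linarith
    qed
    finally show "(LINT x|lborel. 0 * deriv \<phi> x) = - (LINT x|lborel. d x * \<phi> x)" by simp
  qed (simp add: L2_def)
  then have rep: "(LINT x|lborel. exp_tail 1 a x * d x) = 0" for a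
    using weak_deriv_representation[of "\<lambda>x. 0" d 1 a] by simp

  \<comment> \<open>Splitting into positive and negative parts gives genuine densities. The weight
    \<open>exp (- x)\<close> makes them integrable on rays, where \<open>d\<close> is only known to
    be square integrable.\<close>
  define p where "p x = exp (- x) * max (d x) 0" for x
  define q where "q x = exp (- x) * max (- d x) 0" for x
  have [measurable]: "p \<in> borel_measurable borel" "q \<in> borel_measurable borel"
    unfolding p_def q_def by measurable
  have pq0: "0 \<le> p x" "0 \<le> q x" for x by (auto simp: p_def q_def)
  have tail_eq: "exp_tail 1 a x = exp a * (indicator {a<..} x * exp (- x))" for a x
    by (simp add: exp_tail_def exp_diff exp_minus field_simps)
  have tail_int: "integrable lborel (\<lambda>x. exp_tail 1 a x * d x)" for a
    by (intro L2_mult_integrable L2_exp_tail L2d) simp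
  have int: "integrable lborel (\<lambda>x. indicator {a<..} x * p x)"
    "integrable lborel (\<lambda>x. indicator {a<..} x * q x)" for a
  proof -
    have dom: "integrable lborel (\<lambda>x. exp (- a) * (exp_tail 1 a x * d x))"
      using tail_int by simp
    have "exp (- a) * exp_tail 1 a x = indicator {a<..} x * exp (- x)" for x
      unfolding tail_eq by (simp add: exp_minus)
    then have eq: "exp (- a) * (exp_tail 1 a x * d x) = indicator {a<..} x * exp (- x) * d x" for x
      by (simp add: mult.assoc[symmetric])
    show "integrable lborel (\<lambda>x. indicator {a<..} x * p x)"
      by (rule Bochner_Integration.integrable_bound[OF dom]; (measurable)?)
        (unfold eq, auto simp: p_def indicator_def abs_mult)
    show "integrable lborel (\<lambda>x. indicator {a<..} x * q x)"
      by (rule Bochner_Integration.integrable_bound[OF dom]; (measurable)?)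
        (unfold eq, auto simp: q_def indicator_def abs_mult)
  qed
  have eq: "(LINT x|lborel. indicator {a<..} x * p x) = (LINT x|lborel. indicator {a<..} x * q x)" for a
  proof -
    have pw: "exp_tail 1 a x * d x = exp a * (indicator {a<..} x * p x - indicator {a<..} x * q x)" for x
      unfolding tail_eq p_def q_def by (auto simp: max_def algebra_simps)
    have "0 = exp a * ((LINT x|lborel. indicator {a<..} x * p x) - (LINT x|lborel. indicator {a<..} x * q x))"
      using rep[of a] int[of a] unfolding pw by simp
    then show ?thesis by simp
  qed
  have em: "emeasure (density lborel (\<lambda>x. ennreal (f x))) {a<..} = ennreal (LINT x|lborel. indicator {a<..} x * f x)"
    if [measurable]: "f \<in> borel_measurable borel" and f0: "\<And>x. 0 \<le> f x"
      and int: "integrable lborel (\<lambda>x. indicator {a<..} x * f x)" for f :: "real \<Rightarrow> real" and a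
  proof -
    have "emeasure (density lborel (\<lambda>x. ennreal (f x))) {a<..} = (\<integral>\<^sup>+x. ennreal (indicator {a<..} x * f x) \<partial>lborel)"
      by (subst emeasure_density) (auto intro!: nn_integral_cong simp: indicator_def)
    then show ?thesis
      using f0 by (simp add: nn_integral_eq_integral[OF int])
  qed
  \<comment> \<open>Two measures that agree and are finite on all rays \<open>{a<..}\<close>
    coincide.\<close>
  have "density lborel (\<lambda>x. ennreal (p x)) = density lborel (\<lambda>x. ennreal (q x))"
    by (rule measure_eqI_lessThan) (simp_all add: em pq0 int eq)
  then have "AE x in lborel. ennreal (p x) = ennreal (q x)"
    by (intro sigma_finite_measure.density_unique[OF sigma_finite_lborel]) auto
  then show ?thesis
    by eventually_elim (auto simp: pq0 p_def q_def d_def max_def split: if_splits)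
qed

section \<open>Essential supremum of continuous functions\<close>

text \<open>For continuous \<open>u\<close> the set where \<open>\<bar>u\<bar>\<close> is at most
  its essential supremum is closed and of full measure, hence the whole line.\<close>

lemma sup_norm_bounded:
  assumes cont: "continuous_on UNIV u" and bound: "\<And>x. \<bar>u x\<bar> \<le> K"
  shows abs_le_sup_norm: "\<bar>u x\<bar> \<le> sup_norm u" and sup_norm_le: "sup_norm u \<le> K"
proof -
  define S where "S = esssup lborel (\<lambda>x. ereal \<bar>u x\<bar>)"
  have [measurable]: "u \<in> borel_measurable borel"
    using cont by (rule borel_measurable_continuous_onI)
  have upper: "S \<le> ereal K"
    unfolding S_def by (rule esssup_I) (use bound in auto)
  have lower: "ereal \<bar>u x\<bar> \<le> S" for x
  proof -
    have "closed {x. ereal \<bar>u x\<bar> \<le> S}"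
      using cont by (intro closed_Collect_le continuous_intros) auto
    moreover have "AE x in lebesgue. x \<in> {x. ereal \<bar>u x\<bar> \<le> S}"
      using esssup_AE[of "\<lambda>x. ereal \<bar>u x\<bar>" lborel] by (intro AE_completion) (simp add: S_def)
    ultimately show ?thesis
      using mem_closed_if_AE_lebesgue by blast
  qed
  \<comment> \<open>Finiteness must come first, because \<open>real_of_ereal\<close> sends infinite
    values to 0.\<close>
  obtain r where "S = ereal r"
    using upper lower[of 0] by (cases S) auto
  then show "\<bar>u x\<bar> \<le> sup_norm u" "sup_norm u \<le> K"
    using upper lower[of x] unfolding sup_norm_def S_def[symmetric] by auto
qed

section \<open>The lower bound on \<open>H1\<close>\<close>

text \<open>The expression under the root in the final inequality; with \<open>\<beta> = 0\<close>
  it is the part without the point interaction.\<close>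

definition energy :: "real \<Rightarrow> real \<Rightarrow> (real \<Rightarrow> real) \<Rightarrow> real" where
  "energy \<alpha> \<beta> u = (LINT x|lborel. (wderiv u x)\<^sup>2 + \<alpha> * (u x)\<^sup>2) + \<beta> * (u 0)\<^sup>2"

lemma weak_deriv_wderiv: "u \<in> H1 \<Longrightarrow> weak_deriv_L2 u (wderiv u)"
  unfolding H1_def wderiv_def by (simp add: someI_ex)

lemma H1_continuous: "u \<in> H1 \<Longrightarrow> continuous_on UNIV u"
  by (simp add: H1_def)

lemma Ifun_delta_form:
  assumes "u \<in> H1"
  shows "Ifun u (delta_form \<alpha> \<beta>) = energy \<alpha> \<beta> u"
proof -
  have "L2 u" "L2 (wderiv u)"
    using weak_deriv_wderiv[OF assms] by (auto simp: weak_deriv_L2_def)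
  then show ?thesis
    by (simp add: Ifun_def delta_form_def energy_def L2_integrable power2_eq_square[symmetric] mult.assoc)
qed

lemma H1_pointwise_bound:
  assumes "u \<in> H1" "\<alpha> > 0"
  shows "2 * sqrt \<alpha> * (u x)\<^sup>2 \<le> energy \<alpha> 0 u"
  using energy_bound[OF weak_deriv_wderiv[OF assms(1)] H1_continuous[OF assms(1)], of "sqrt \<alpha>" x] assms(2)
  by (simp add: energy_def)

text \<open>Supplies the uniform bound that keeps the sup norm finite, and with it the bound on the
  sup norm itself.\<close>

lemma H1_abs_bound:
  assumes "u \<in> H1" "\<alpha> > 0"
  shows "\<bar>u x\<bar> \<le> sqrt (energy \<alpha> 0 u / (2 * sqrt \<alpha>))"
  using H1_pointwise_bound[OF assms, of x] assms(2)
  by (intro real_le_rsqrt) (simp add: field_simps)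

text \<open>Any positive \<open>\<alpha>\<close> would give the required boundedness; 1 is
  taken.\<close>

lemma H1_abs_le_sup_norm: "u \<in> H1 \<Longrightarrow> \<bar>u x\<bar> \<le> sup_norm u"
  using abs_le_sup_norm[OF H1_continuous H1_abs_bound[of u 1]] by simp

lemma H1_sup_norm_pos:
  assumes "u \<in> H1" "u \<noteq> (\<lambda>x. 0)"
  shows "sup_norm u > 0"
proof -
  obtain x where "u x \<noteq> 0" using assms(2) by auto
  then show ?thesis using H1_abs_le_sup_norm[OF assms(1), of x] by auto
qed

text \<open>The pointwise bound passes to the sup norm because its right-hand side does not depend
  on the point, and the point interaction can lower the energy by at most
  \<open>max (- \<beta>) 0\<close> times the squared norm.\<close>

lemma energy_lower_bound:
  assumes u: "u \<in> H1" and \<alpha>: "\<alpha> > 0"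
  shows "(2 * sqrt \<alpha> - max (- \<beta>) 0) * (sup_norm u)\<^sup>2 \<le> energy \<alpha> \<beta> u"
proof -
  have s: "0 < sqrt \<alpha>" using \<alpha> by simp
  have "0 \<le> 2 * sqrt \<alpha> * (u 0)\<^sup>2" using s by simp
  then have E0: "0 \<le> energy \<alpha> 0 u" using H1_pointwise_bound[OF u \<alpha>, of 0] by linarith
  have nonneg: "0 \<le> sup_norm u" using H1_abs_le_sup_norm[OF u, of 0] by simp
  have "sup_norm u \<le> sqrt (energy \<alpha> 0 u / (2 * sqrt \<alpha>))"
    by (rule sup_norm_le[OF H1_continuous[OF u] H1_abs_bound[OF u \<alpha>]])
  then have "(sup_norm u)\<^sup>2 \<le> (sqrt (energy \<alpha> 0 u / (2 * sqrt \<alpha>)))\<^sup>2"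
    using nonneg by (rule power_mono)
  also have "\<dots> = energy \<alpha> 0 u / (2 * sqrt \<alpha>)"
    using E0 s by simp
  finally have 1: "2 * sqrt \<alpha> * (sup_norm u)\<^sup>2 \<le> energy \<alpha> 0 u"
    using s by (simp add: field_simps)
  have "(u 0)\<^sup>2 \<le> (sup_norm u)\<^sup>2"
    using power_mono[OF H1_abs_le_sup_norm[OF u, of 0], of 2] by simp
  then have "- \<beta> * (u 0)\<^sup>2 \<le> max (- \<beta>) 0 * (sup_norm u)\<^sup>2"
    by (intro mult_mono) auto
  with 1 show ?thesis by (simp add: energy_def algebra_simps)
qed

section \<open>Exponential peaks as extremals\<close>

text \<open>Up to the factor \<open>1 / (2 s)\<close>, the Green's function of
  \<open>- u'' + s^2 u\<close> with pole \<open>a\<close>.\<close>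

definition peak :: "real \<Rightarrow> real \<Rightarrow> real \<Rightarrow> real" where
  "peak s a x = exp (- s * \<bar>x - a\<bar>)"

text \<open>The classical derivative away from \<open>a\<close>; at \<open>a\<close> itself it is 0,
  as \<open>sgn 0 = 0\<close>.\<close>

definition peak_deriv :: "real \<Rightarrow> real \<Rightarrow> real \<Rightarrow> real" where
  "peak_deriv s a x = - s * sgn (x - a) * peak s a x"

lemma continuous_peak: "continuous_on S (peak s a)"
  unfolding peak_def by (intro continuous_intros)

lemma DERIV_peak:
  assumes "x \<noteq> a"
  shows "(peak s a has_field_derivative peak_deriv s a x) (at x)"
proof (cases "x > a")
  case True
  have "((\<lambda>x. exp (- s * (x - a))) has_field_derivative peak_deriv s a x) (at x)"
    using True by (auto intro!: derivative_eq_intros simp: peak_deriv_def peak_def)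
  then show ?thesis
    using True by (elim has_field_derivative_transform_within_open[where S="{a<..}"]) (auto simp: peak_def)
next
  case False
  with assms have "x < a" by simp
  have "((\<lambda>x. exp (s * (x - a))) has_field_derivative peak_deriv s a x) (at x)"
    using \<open>x < a\<close> by (auto intro!: derivative_eq_intros simp: peak_deriv_def peak_def algebra_simps)
  then show ?thesis
    using \<open>x < a\<close> by (elim has_field_derivative_transform_within_open[where S="{..<a}"])
      (auto simp: peak_def algebra_simps)
qed

text \<open>Off the point \<open>a\<close> the square of the peak is the sum of the squares of a
  right tail and a reflected one, each contributing \<open>1 / (2 s)\<close>.\<close>

lemma peak_square_integral:
  assumes s: "s > 0"
  shows "has_bochner_integral lborel (\<lambda>x. (peak s a x)\<^sup>2) (1 / s)"
proof -
  note right = exp_tail_square_integral[OF s, of a]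
  have left: "has_bochner_integral lborel (\<lambda>x. (exp_tail s (- a) (- x))\<^sup>2) (1 / (2 * s))"
    using exp_tail_square_integral[OF s, of "- a"]
      lborel_integrable_real_affine[of "\<lambda>x. (exp_tail s (- a) x)\<^sup>2" "-1" 0]
      lborel_integral_real_affine[of "-1" "\<lambda>x. (exp_tail s (- a) x)\<^sup>2" 0]
    by (simp add: has_bochner_integral_iff)
  have "has_bochner_integral lborel (\<lambda>x. (exp_tail s a x)\<^sup>2 + (exp_tail s (- a) (- x))\<^sup>2)
      (1 / (2 * s) + 1 / (2 * s))"
    by (rule has_bochner_integral_add[OF right left])
  also have "1 / (2 * s) + 1 / (2 * s) = 1 / s" by (simp add: field_simps)
  finally have 1: "has_bochner_integral lborel (\<lambda>x. (exp_tail s a x)\<^sup>2 + (exp_tail s (- a) (- x))\<^sup>2) (1 / s)" .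
  have 2: "AE x in lborel. (exp_tail s a x)\<^sup>2 + (exp_tail s (- a) (- x))\<^sup>2 = (peak s a x)\<^sup>2"
    using AE_lborel_singleton[of a]
  proof eventually_elim
    case (elim x)
    then consider "a < x" | "x < a" by linarith
    then show ?case by cases (auto simp: exp_tail_def peak_def algebra_simps)
  qed
  have [measurable]: "peak s a \<in> borel_measurable borel"
    by (rule borel_measurable_continuous_onI[OF continuous_peak])
  have "has_bochner_integral lborel (\<lambda>x. (exp_tail s a x)\<^sup>2 + (exp_tail s (- a) (- x))\<^sup>2) (1 / s) \<longleftrightarrow>
      has_bochner_integral lborel (\<lambda>x. (peak s a x)\<^sup>2) (1 / s)"
    by (rule has_bochner_integral_cong_AE) (use 2 in auto)
  with 1 show ?thesis by simp
qed

text \<open>The product of peak and test function is continuous and differentiable off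
  \<open>a\<close>, so the fundamental theorem with one exceptional point applies, and the boundary
  terms vanish.\<close>

lemma peak_weak_deriv:
  assumes s: "s > 0"
  shows "weak_deriv_L2 (peak s a) (peak_deriv s a)"
proof -
  have [measurable]: "peak s a \<in> borel_measurable borel"
    by (rule borel_measurable_continuous_onI[OF continuous_peak])
  have [measurable]: "peak_deriv s a \<in> borel_measurable borel"
    unfolding peak_deriv_def by measurable
  have L2p: "L2 (peak s a)"
    using peak_square_integral[OF s, of a] by (simp add: L2_def has_bochner_integral_iff)
  have "integrable lborel (\<lambda>x. (peak_deriv s a x)\<^sup>2)"
  proof (rule Bochner_Integration.integrable_bound)
    show "integrable lborel (\<lambda>x. s\<^sup>2 * (peak s a x)\<^sup>2)"
      using L2p by (simp add: L2_def)
    show "AE x in lborel. norm ((peak_deriv s a x)\<^sup>2) \<le> norm (s\<^sup>2 * (peak s a x)\<^sup>2)"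
      by (auto simp: peak_deriv_def power_mult_distrib sgn_if)
  qed measurable
  then have L2d: "L2 (peak_deriv s a)" by (simp add: L2_def)
  have "(LINT x|lborel. peak s a x * deriv \<phi> x) = - (LINT x|lborel. peak_deriv s a x * \<phi> x)"
    if \<phi>: "test_fun \<phi>" for \<phi>
  proof -
    obtain R where R: "\<And>x. \<bar>x\<bar> > R \<Longrightarrow> \<phi> x = 0" and sm: "smooth \<phi>"
      using \<phi> by (auto simp: test_fun_iff)
    obtain R' where R': "\<And>x. \<bar>x\<bar> > R' \<Longrightarrow> deriv \<phi> x = 0"
      using test_fun_deriv[OF \<phi>] by (auto simp: test_fun_iff)
    \<comment> \<open>The absolute values and the summand 1 make \<open>b\<close> positive and
      strictly larger than both radii, so \<open>\<phi>\<close> vanishes at the endpoints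
      too.\<close>
    define b where "b = max \<bar>R\<bar> \<bar>R'\<bar> + 1"
    define f where "f x = peak s a x * deriv \<phi> x + peak_deriv s a x * \<phi> x" for x
    have int: "integrable lborel (\<lambda>x. peak s a x * deriv \<phi> x)"
      "integrable lborel (\<lambda>x. peak_deriv s a x * \<phi> x)"
      using L2p L2d test_fun_L2[OF \<phi>] test_fun_L2[OF test_fun_deriv[OF \<phi>]]
      by (auto intro: L2_mult_integrable)
    have "(f has_integral (peak s a b * \<phi> b - peak s a (- b) * \<phi> (- b))) {- b..b}"
    proof (rule fundamental_theorem_of_calculus_interior_strong[where S="{a}"])
      show "((\<lambda>x. peak s a x * \<phi> x) has_vector_derivative f x) (at x)" if "x \<in> {- b<..<b} - {a}" for x
        unfolding has_real_derivative_iff_has_vector_derivative[symmetric] f_def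
        using that by (auto intro!: derivative_eq_intros DERIV_peak smooth_DERIV[OF sm])
      show "continuous_on {- b..b} (\<lambda>x. peak s a x * \<phi> x)"
        by (intro continuous_intros continuous_peak smooth_continuous sm)
    qed (auto simp: b_def)
    moreover have "\<phi> b = 0" "\<phi> (- b) = 0"
      by (auto intro!: R simp: b_def)
    ultimately have "(f has_integral 0) {- b..b}" by simp
    then have "(f has_integral 0) UNIV"
    proof (rule has_integral_on_superset)
      show "f x = 0" if "x \<notin> {- b..b}" for x
      proof -
        have "\<bar>x\<bar> > b" using that by auto
        then have "\<bar>x\<bar> > R" "\<bar>x\<bar> > R'" by (auto simp: b_def)
        then show ?thesis by (simp add: f_def R R')
      qed
    qed simp
    \<comment> \<open>The fundamental theorem yields a gauge integral; integrability identifies it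
      with the Lebesgue integral.\<close>
    moreover have "(f has_integral (LINT x|lborel. f x)) UNIV"
      unfolding f_def by (intro has_integral_integral_lborel Bochner_Integration.integrable_add int)
    ultimately have "(LINT x|lborel. f x) = 0" by (rule has_integral_unique[symmetric])
    then show ?thesis using int by (simp add: f_def)
  qed
  then show ?thesis using L2p L2d by (simp add: weak_deriv_L2_def)
qed

lemma peak_H1: "s > 0 \<Longrightarrow> peak s a \<in> H1"
  unfolding H1_def using continuous_peak peak_weak_deriv by blast

lemma peak_sup_norm:
  assumes "s > 0"
  shows "sup_norm (peak s a) = 1"
proof -
  have le: "\<bar>peak s a x\<bar> \<le> 1" for x
    using assms by (simp add: peak_def)
  have "peak s a a = 1" by (simp add: peak_def)
  then show ?thesis
    using sup_norm_le[OF continuous_peak le] abs_le_sup_norm[OF continuous_peak le, of a] by simp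
qed

text \<open>Off \<open>a\<close> the squared derivative equals \<alpha> times the squared peak, so
  both terms contribute equally. Uniqueness of weak derivatives transfers this to the chosen
  \<open>wderiv\<close>.\<close>

lemma peak_energy:
  assumes "\<alpha> > 0"
  shows "energy \<alpha> \<beta> (peak (sqrt \<alpha>) a) = 2 * sqrt \<alpha> + \<beta> * exp (- (2 * sqrt \<alpha> * \<bar>a\<bar>))"
proof -
  define s where "s = sqrt \<alpha>"
  have s: "s > 0" "s * s = \<alpha>" using assms by (auto simp: s_def)
  note wd = weak_deriv_wderiv[OF peak_H1[OF s(1), of a]] peak_weak_deriv[OF s(1), of a]
  have [measurable]: "wderiv (peak s a) \<in> borel_measurable borel" "peak s a \<in> borel_measurable borel"
    using wd(1) by (auto simp: weak_deriv_L2_def intro: L2_measurable)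
  have "(LINT x|lborel. (wderiv (peak s a) x)\<^sup>2 + \<alpha> * (peak s a x)\<^sup>2) = (LINT x|lborel. 2 * \<alpha> * (peak s a x)\<^sup>2)"
  proof (rule integral_cong_AE)
    show "AE x in lborel. (wderiv (peak s a) x)\<^sup>2 + \<alpha> * (peak s a x)\<^sup>2 = 2 * \<alpha> * (peak s a x)\<^sup>2"
      using weak_deriv_unique[OF wd] AE_lborel_singleton[of a]
    proof eventually_elim
      case (elim x)
      then show ?case
        by (auto simp: peak_deriv_def power_mult_distrib sgn_if power2_eq_square s(2)[symmetric])
    qed
  qed measurable
  also have "\<dots> = 2 * s"
    using peak_square_integral[OF s(1), of a] s by (auto simp: has_bochner_integral_iff field_simps)
  finally show ?thesis
    by (simp add: energy_def s_def[symmetric] peak_def power2_eq_square flip: exp_add)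
qed

text \<open>A sequence covers both signs of \<beta>: for \<open>\<beta> < 0\<close> it is constantly
  the peak at 0, otherwise the peaks move off to infinity, where the point interaction is no longer
  felt.\<close>

lemma minimizing_sequence:
  assumes "\<alpha> > 0"
  obtains u where "\<And>n. u n \<in> H1" "\<And>n. sup_norm (u n) = 1"
    "(\<lambda>n::nat. energy \<alpha> \<beta> (u n)) \<longlonglongrightarrow> 2 * sqrt \<alpha> - max (- \<beta>) 0"
proof (cases "\<beta> < 0")
  case True
  show thesis
    by (rule that[of "\<lambda>n. peak (sqrt \<alpha>) 0"]) (use assms True in \<open>auto simp: peak_H1 peak_sup_norm peak_energy\<close>)
next
  case False
  have "(\<lambda>n. exp (- (2 * sqrt \<alpha> * real n))) \<longlonglongrightarrow> 0"
    using assms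
    by (intro filterlim_compose[OF exp_at_bot] filterlim_uminus_at_bot[THEN iffD2])
      (simp add: filterlim_tendsto_pos_mult_at_top[OF tendsto_const] filterlim_real_sequentially)
  then have "(\<lambda>n. 2 * sqrt \<alpha> + \<beta> * exp (- (2 * sqrt \<alpha> * \<bar>real n\<bar>))) \<longlonglongrightarrow> 2 * sqrt \<alpha> + \<beta> * 0"
    unfolding abs_of_nat by (intro tendsto_intros)
  then show thesis
    by (intro that[of "\<lambda>n. peak (sqrt \<alpha>) (real n)"]) (use assms False in \<open>auto simp: peak_H1 peak_sup_norm peak_energy\<close>)
qed

theorem theorem4p5:
  fixes \<alpha> \<beta> :: real
  assumes "\<alpha> > 0"
  defines "\<beta>m \<equiv> max (- \<beta>) 0"
  shows "mV (delta_form \<alpha> \<beta>) = ereal (2 * sqrt \<alpha> - \<beta>m) \<and>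
    (2 * sqrt \<alpha> + \<beta> > 0 \<longrightarrow>
       (\<forall>u \<in> H1. sup_norm u \<le> (2 * sqrt \<alpha> - \<beta>m) powr (-1/2) *
            sqrt ((LINT x|lborel. (wderiv u x)\<^sup>2 + \<alpha> * (u x)\<^sup>2) + \<beta> * (u 0)\<^sup>2))
     \<and> (\<forall>C. (\<forall>u \<in> H1. sup_norm u \<le> C *
            sqrt ((LINT x|lborel. (wderiv u x)\<^sup>2 + \<alpha> * (u x)\<^sup>2) + \<beta> * (u 0)\<^sup>2))
          \<longrightarrow> (2 * sqrt \<alpha> - \<beta>m) powr (-1/2) \<le> C))"
proof -
  define \<kappa> where "\<kappa> = 2 * sqrt \<alpha> - \<beta>m"
  have lower: "\<kappa> * (sup_norm u)\<^sup>2 \<le> energy \<alpha> \<beta> u" if "u \<in> H1" for u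
    using energy_lower_bound[OF that assms(1)] by (simp add: \<kappa>_def \<beta>m_def)
  obtain v where v: "\<And>n. v n \<in> H1" "\<And>n. sup_norm (v n) = 1"
    and lim: "(\<lambda>n::nat. energy \<alpha> \<beta> (v n)) \<longlonglongrightarrow> \<kappa>"
    using minimizing_sequence[OF assms(1), of \<beta>] unfolding \<kappa>_def \<beta>m_def by blast
  \<comment> \<open>Needed to see that the \<open>v n\<close>, having norm 1, are admissible in the
    infimum.\<close>
  have "sup_norm (\<lambda>x. 0) = 0"
    using sup_norm_le[of "\<lambda>x. 0" 0] abs_le_sup_norm[of "\<lambda>x. 0" 0] by (auto intro: antisym)
  with v(2) have v0: "v n \<noteq> (\<lambda>x. 0)" for n by (metis zero_neq_one)
  have "mV (delta_form \<alpha> \<beta>) = ereal \<kappa>"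
  proof (rule antisym)
    have "mV (delta_form \<alpha> \<beta>) \<le> ereal (energy \<alpha> \<beta> (v n))" for n
      unfolding mV_def by (rule INF_lower2[of "v n"]) (use v v0 in \<open>auto simp: Ifun_delta_form\<close>)
    then show "mV (delta_form \<alpha> \<beta>) \<le> ereal \<kappa>"
      using LIMSEQ_le_const[OF tendsto_ereal[OF lim]] by blast
    show "ereal \<kappa> \<le> mV (delta_form \<alpha> \<beta>)"
      unfolding mV_def
    proof (rule INF_greatest)
      fix u assume "u \<in> H1 - {\<lambda>x. 0}"
      then have u: "u \<in> H1" "u \<noteq> (\<lambda>x. 0)" by auto
      then show "ereal \<kappa> \<le> ereal (Ifun u (delta_form \<alpha> \<beta>) / (sup_norm u)\<^sup>2)"
        using lower[OF u(1)] H1_sup_norm_pos[OF u] by (simp add: Ifun_delta_form pos_le_divide_eq)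
    qed
  qed
  moreover have "(\<forall>u\<in>H1. sup_norm u \<le> \<kappa> powr (-1/2) * sqrt (energy \<alpha> \<beta> u)) \<and>
      (\<forall>C. (\<forall>u\<in>H1. sup_norm u \<le> C * sqrt (energy \<alpha> \<beta> u)) \<longrightarrow> \<kappa> powr (-1/2) \<le> C)"
    if pos: "2 * sqrt \<alpha> + \<beta> > 0"
  proof -
    \<comment> \<open>\<open>\<kappa>\<close> is the smaller of \<open>2 * sqrt \<alpha>\<close> and
      \<open>2 * sqrt \<alpha> + \<beta>\<close>, both positive here.\<close>
    have \<kappa>: "\<kappa> > 0" using pos assms(1) by (auto simp: \<kappa>_def \<beta>m_def max_def)
    then have powr: "\<kappa> powr (-1/2) = 1 / sqrt \<kappa>"
      by (simp add: powr_minus_divide powr_half_sqrt)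
    have "sup_norm u \<le> 1 / sqrt \<kappa> * sqrt (energy \<alpha> \<beta> u)" if u: "u \<in> H1" for u
    proof -
      have "sqrt \<kappa> * sup_norm u \<le> sqrt (energy \<alpha> \<beta> u)"
        using lower[OF u] \<kappa> by (intro real_le_rsqrt) (simp add: power_mult_distrib)
      then show ?thesis using \<kappa> by (simp add: field_simps)
    qed
    \<comment> \<open>Sharpness: inserting \<open>v n\<close> into the inequality with constant
      \<open>C\<close> and letting \<open>n\<close> tend to infinity gives
      \<open>1 \<le> C * sqrt \<kappa>\<close>.\<close>
    moreover have "1 / sqrt \<kappa> \<le> C" if C: "\<And>u. u \<in> H1 \<Longrightarrow> sup_norm u \<le> C * sqrt (energy \<alpha> \<beta> u)" for C
    proof -
      have "(\<lambda>n. C * sqrt (energy \<alpha> \<beta> (v n))) \<longlonglongrightarrow> C * sqrt \<kappa>"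
        by (intro tendsto_intros lim)
      moreover have "1 \<le> C * sqrt (energy \<alpha> \<beta> (v n))" for n
        using C[OF v(1)[of n]] v(2)[of n] by simp
      ultimately have "1 \<le> C * sqrt \<kappa>"
        by (intro LIMSEQ_le_const) auto
      then show ?thesis using \<kappa> by (simp add: field_simps)
    qed
    ultimately show ?thesis unfolding powr by blast
  qed
  ultimately show ?thesis
    unfolding \<kappa>_def energy_def by blast
qed

end
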